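(* Let $\mathfrak{X}\subseteq\mathcal{P}(\mathbb{N})$ be an arithmetically closed family of reals. If the poset $\mathfrak{X}/\mathrm{Fin}$ has the countable chain condition (c.c.c.), then $\mathfrak{X}$ is countable.
   Context: A family $\mathfrak{X}\subseteq\mathcal{P}(\mathbb{N})$ is arithmetically closed if whenever $A\in\mathfrak{X}$ and $B\subseteq\mathbb{N}$ is arithmetically definable from $A$, then $B\in\mathfrak{X}$. The poset $\mathfrak{X}/\mathrm{Fin}$ consists of the infinite sets in $\mathfrak{X}$, ordered by almost inclusion: $A\leq B$ iff $A\subseteq_{\mathrm{Fin}}B$, i.e. $A\setminus B$ is finite. *)

theory Defs
  imports Main "HOL-Library.Countable_Set"
begin

text \<open>First-order formulas in the language \<open>0, 1, +, *, <\<close> of arithmetic expanded by one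
  unary predicate symbol (constructor \<open>Mem\<close>), which is interpreted by the oracle set.
  Variables are named by natural numbers.\<close>

datatype aterm =
    Var nat
  | Zero
  | One
  | Add aterm aterm
  | Mult aterm aterm

datatype aform =
    Eq aterm aterm
  | Less aterm aterm
  | Mem aterm
  | Neg aform
  | Conj aform aform
  | Exists nat aform

primrec aterm_val :: "(nat \<Rightarrow> nat) \<Rightarrow> aterm \<Rightarrow> nat" where
  "aterm_val e (Var x) = e x"
| "aterm_val e Zero = 0"
| "aterm_val e One = 1"
| "aterm_val e (Add s t) = aterm_val e s + aterm_val e t"
| "aterm_val e (Mult s t) = aterm_val e s * aterm_val e t"

primrec aform_sat :: "nat set \<Rightarrow> (nat \<Rightarrow> nat) \<Rightarrow> aform \<Rightarrow> bool" where
  "aform_sat A e (Eq s t) \<longleftrightarrow> aterm_val e s = aterm_val e t"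
| "aform_sat A e (Less s t) \<longleftrightarrow> aterm_val e s < aterm_val e t"
| "aform_sat A e (Mem t) \<longleftrightarrow> aterm_val e t \<in> A"
| "aform_sat A e (Neg \<phi>) \<longleftrightarrow> \<not> aform_sat A e \<phi>"
| "aform_sat A e (Conj \<phi> \<psi>) \<longleftrightarrow> aform_sat A e \<phi> \<and> aform_sat A e \<psi>"
| "aform_sat A e (Exists x \<phi>) \<longleftrightarrow> (\<exists>n. aform_sat A (e(x := n)) \<phi>)"

primrec aterm_vars :: "aterm \<Rightarrow> nat set" where
  "aterm_vars (Var x) = {x}"
| "aterm_vars Zero = {}"
| "aterm_vars One = {}"
| "aterm_vars (Add s t) = aterm_vars s \<union> aterm_vars t"
| "aterm_vars (Mult s t) = aterm_vars s \<union> aterm_vars t"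

primrec free_vars :: "aform \<Rightarrow> nat set" where
  "free_vars (Eq s t) = aterm_vars s \<union> aterm_vars t"
| "free_vars (Less s t) = aterm_vars s \<union> aterm_vars t"
| "free_vars (Mem t) = aterm_vars t"
| "free_vars (Neg \<phi>) = free_vars \<phi>"
| "free_vars (Conj \<phi> \<psi>) = free_vars \<phi> \<union> free_vars \<psi>"
| "free_vars (Exists x \<phi>) = free_vars \<phi> - {x}"

text \<open>Only variable \<open>0\<close> may occur free in the defining formula, so the constant assignment
  below serves merely to give it the value \<open>n\<close>.\<close>

definition arith_definable_from :: "nat set \<Rightarrow> nat set \<Rightarrow> bool" where
  "arith_definable_from A B \<longleftrightarrow>
     (\<exists>\<phi>. free_vars \<phi> \<subseteq> {0} \<and> B = {n. aform_sat A (\<lambda>_. n) \<phi>})"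

definition arithmetically_closed :: "nat set set \<Rightarrow> bool" where
  "arithmetically_closed X \<longleftrightarrow> (\<forall>A\<in>X. \<forall>B. arith_definable_from A B \<longrightarrow> B \<in> X)"

definition compatible_in :: "'a set \<Rightarrow> ('a \<Rightarrow> 'a \<Rightarrow> bool) \<Rightarrow> 'a \<Rightarrow> 'a \<Rightarrow> bool" where
  "compatible_in P le a b \<longleftrightarrow> (\<exists>c\<in>P. le c a \<and> le c b)"

text \<open>Antichains are meant in the sense of forcing: distinct elements are incompatible, not
  merely incomparable.\<close>

definition antichain_in :: "'a set \<Rightarrow> ('a \<Rightarrow> 'a \<Rightarrow> bool) \<Rightarrow> 'a set \<Rightarrow> bool" where
  "antichain_in P le S \<longleftrightarrow> S \<subseteq> P \<and> pairwise (\<lambda>a b. \<not> compatible_in P le a b) S"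

definition ccc :: "'a set \<Rightarrow> ('a \<Rightarrow> 'a \<Rightarrow> bool) \<Rightarrow> bool" where
  "ccc P le \<longleftrightarrow> (\<forall>S. antichain_in P le S \<longrightarrow> countable S)"

definition almost_subset :: "nat set \<Rightarrow> nat set \<Rightarrow> bool" where
  "almost_subset A B \<longleftrightarrow> finite (A - B)"

text \<open>The poset \<open>X/Fin\<close> has carrier \<open>mod_Fin X\<close> and order \<open>almost_subset\<close>. As a relation on sets
  this is only a preorder. Almost equal infinite members of \<open>X\<close> are compatible, so an antichain
  contains at most one set from each class, and the chain condition is the same as for the
  quotient by almost equality.\<close>

definition mod_Fin :: "nat set set \<Rightarrow> nat set set" where
  "mod_Fin X = {A \<in> X. infinite A}"

end

theory Submission
  imports Defs
begin

text \<open>Attach to each \<open>A\<close> in \<open>X\<close> the infinite set of codes of its initial segments. It is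
  arithmetically definable from \<open>A\<close>, hence lies in \<open>X\<close>, and distinct \<open>A\<close> receive almost disjoint
  sets, because a code of a long initial segment of \<open>A\<close> codes no long initial segment of another
  set. These sets therefore form an antichain in \<open>X/Fin\<close> that is indexed injectively by \<open>X\<close>.
  Codes are as in the \<open>\<beta>\<close>-function lemma: for \<open>d = n!\<close> the numbers \<open>1 + (i + 1) d\<close> with \<open>i < n\<close> are
  pairwise coprime, so a product of some of them determines its factors.\<close>

definition codes_upto :: "nat set \<Rightarrow> nat \<Rightarrow> nat \<Rightarrow> bool" where
  "codes_upto A n m \<longleftrightarrow>
     (\<exists>c d. m = (c + d) * (c + d) + c \<and> (\<forall>i<n. i \<in> A \<longleftrightarrow> 1 + (i + 1) * d dvd c))"

text \<open>The bound \<open>n \<le> m\<close> makes \<open>segment_codes A\<close> infinite: otherwise one code might serve for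
  all \<open>n\<close>, for instance if \<open>A\<close> is empty. Minimality leaves one code for each \<open>n\<close>.\<close>

definition least_code :: "nat set \<Rightarrow> nat \<Rightarrow> nat" where
  "least_code A n = (LEAST m. n \<le> m \<and> codes_upto A n m)"

definition segment_codes :: "nat set \<Rightarrow> nat set" where
  "segment_codes A = range (least_code A)"

text \<open>With \<open>s = c + d\<close>, the bound \<open>c\<close> \<le> \<open>s\<close> puts
  the value between \<open>s * s\<close> and \<open>(s + 1) * (s + 1)\<close>, the latter excluded.
  So it determines \<open>s\<close>, and then \<open>c\<close> and \<open>d\<close>.\<close>

lemma square_pairing_inj:
  fixes c d c' d' :: nat
  assumes "(c + d) * (c + d) + c = (c' + d') * (c' + d') + c'"
  shows "c = c' \<and> d = d'"
proof -
  have less: "(x + y) * (x + y) + x < (x' + y') * (x' + y') + x'"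
    if "x + y < x' + y'" for x y x' y' :: nat
  proof -
    have "(x + y) * (x + y) + x < Suc (x + y) * Suc (x + y)" by simp
    also have "\<dots> \<le> (x' + y') * (x' + y')" using that by (intro mult_le_mono) auto
    finally show ?thesis by simp
  qed
  have "c + d = c' + d'"
    using less[of c d c' d'] less[of c' d' c d] assms by (metis less_irrefl nat_neq_iff)
  with assms show ?thesis by simp
qed

text \<open>Decoding at \<open>i\<close> uses only \<open>c\<close> and \<open>d\<close>, which
  \<open>m\<close> determines; the lengths \<open>n\<close> and \<open>n'\<close> may
  differ.\<close>

lemma codes_upto_agree:
  assumes "codes_upto A n m" "codes_upto A' n' m" "i < n" "i < n'"
  shows "i \<in> A \<longleftrightarrow> i \<in> A'"
proof -
  obtain c d where m: "m = (c + d) * (c + d) + c" and A: "\<forall>i<n. i \<in> A \<longleftrightarrow> 1 + (i + 1) * d dvd c"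
    using assms(1) unfolding codes_upto_def by blast
  obtain c' d' where m': "m = (c' + d') * (c' + d') + c'"
    and A': "\<forall>i<n'. i \<in> A' \<longleftrightarrow> 1 + (i + 1) * d' dvd c'"
    using assms(2) unfolding codes_upto_def by blast
  have "c = c' \<and> d = d'"
    by (rule square_pairing_inj) (rule trans[OF m[symmetric] m'])
  with A A' assms(3,4) show ?thesis
    by simp
qed

lemma coprime_beta_moduli:
  fixes i j n :: nat
  assumes "i < j" "j < n"
  shows "coprime (1 + (i + 1) * fact n) (1 + (j + 1) * fact n :: nat)"
proof (rule coprimeI)
  fix g :: nat
  assume gi: "g dvd 1 + (i + 1) * fact n" and gj: "g dvd 1 + (j + 1) * fact n"
  \<comment> \<open>\<open>g\<close> divides a number that is 1 modulo
    \<open>fact n\<close>.\<close>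
  have cop: "coprime g (fact n)"
  proof (rule coprimeI)
    fix k :: nat
    assume "k dvd g" "k dvd fact n"
    then have "k dvd 1 + (i + 1) * fact n" "k dvd (i + 1) * fact n"
      using gi by (auto intro: dvd_trans)
    then show "is_unit k"
      using dvd_add_left_iff by blast
  qed
  have "(1 + (j + 1) * fact n) - (1 + (i + 1) * fact n) = (j - i) * (fact n :: nat)"
    by (simp add: diff_mult_distrib)
  with gi gj have "g dvd (j - i) * fact n"
    by (metis dvd_diff_nat)
  with cop have "g dvd j - i"
    by (simp add: coprime_dvd_mult_left_iff)
  \<comment> \<open>Here the choice of a factorial matters: all differences of indices below
    \<open>n\<close> divide it.\<close>
  moreover have "j - i dvd fact n"
    using assms by (intro dvd_fact) auto
  ultimately have "g dvd fact n"
    by (rule dvd_trans)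
  with cop show "is_unit g"
    by (metis coprime_common_divisor dvd_refl)
qed

lemma ex_codes_upto: "\<exists>m\<ge>n. codes_upto A n m"
proof -
  define q :: "nat \<Rightarrow> nat" where "q i = 1 + (i + 1) * fact n" for i
  define c where "c = (\<Prod>i\<in>A \<inter> {..<n}. q i)"
  have cop: "coprime (q i) (q j)" if "i \<noteq> j" "i < n" "j < n" for i j
    using that coprime_beta_moduli[of i j n] coprime_beta_moduli[of j i n]
    unfolding q_def by (metis coprime_commute nat_neq_iff)
  have "i \<in> A \<longleftrightarrow> q i dvd c" if "i < n" for i
  proof
    assume "i \<in> A"
    with that show "q i dvd c"
      unfolding c_def by (intro dvd_prodI) auto
  next
    assume dvd: "q i dvd c"
    show "i \<in> A"
    proof (rule ccontr)
      assume "i \<notin> A"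
      \<comment> \<open>Every factor of \<open>c\<close> has an index in \<open>A\<close>, hence
        different from \<open>i\<close>.\<close>
      then have "coprime (q i) c"
        unfolding c_def using that by (intro prod_coprime_right cop) auto
      with dvd have "q i = 1"
        by (metis coprime_common_divisor dvd_refl nat_dvd_1_iff_1)
      then show False
        by (simp add: q_def)
    qed
  qed
  then have "codes_upto A n ((c + fact n) * (c + fact n) + c)"
    unfolding codes_upto_def q_def by blast
  moreover have "n \<le> (c + fact n) * (c + fact n) + c"
  proof -
    \<comment> \<open>The component \<open>d = fact n\<close> alone makes the code large enough,
      even when \<open>c\<close> is the empty product.\<close>
    have "n \<le> c + fact n"
      using fact_ge_self[of n] by linarith
    also have "\<dots> \<le> (c + fact n) * (c + fact n)"
      by (rule le_square)
    finally show ?thesis by simp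
  qed
  ultimately show ?thesis by blast
qed

lemma least_code_ge: "n \<le> least_code A n"
  and codes_upto_least_code: "codes_upto A n (least_code A n)"
  using LeastI_ex[OF ex_codes_upto[of n A, unfolded Bex_def]] unfolding least_code_def by auto

lemma infinite_segment_codes: "infinite (segment_codes A)"
  unfolding segment_codes_def infinite_nat_iff_unbounded_le using least_code_ge by blast

lemma finite_segment_codes_Int:
  assumes "A \<noteq> A'"
  shows "finite (segment_codes A \<inter> segment_codes A')"
proof -
  obtain i where i: "\<not> (i \<in> A \<longleftrightarrow> i \<in> A')"
    using assms by blast
  \<comment> \<open>A common code cannot be read with lengths above \<open>i\<close> on both sides,
    as it would decode both ways at \<open>i\<close>. So it is the least code of one of the sets for
    a length at most \<open>i\<close>.\<close>
  have "segment_codes A \<inter> segment_codes A' \<subseteq> least_code A ` {..i} \<union> least_code A' ` {..i}"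
  proof
    fix m
    assume "m \<in> segment_codes A \<inter> segment_codes A'"
    then obtain n n' where m: "m = least_code A n" "m = least_code A' n'"
      unfolding segment_codes_def by blast
    then have "codes_upto A n m" "codes_upto A' n' m"
      using codes_upto_least_code by metis+
    with i have "n \<le> i \<or> n' \<le> i"
      using codes_upto_agree not_le by metis
    with m show "m \<in> least_code A ` {..i} \<union> least_code A' ` {..i}"
      by blast
  qed
  then show ?thesis
    by (rule finite_subset) simp
qed

text \<open>Spelling out minimality leaves only number quantifiers, ready for translation into a
  formula.\<close>

lemma mem_segment_codes_iff:
  "m \<in> segment_codes A \<longleftrightarrow>
     (\<exists>n. (n \<le> m \<and> codes_upto A n m) \<and> (\<forall>m'<m. \<not> (n \<le> m' \<and> codes_upto A n m')))"
proof -
  have "m = least_code A n \<longleftrightarrow>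
      (n \<le> m \<and> codes_upto A n m) \<and> (\<forall>m'<m. \<not> (n \<le> m' \<and> codes_upto A n m'))" for n
    using least_code_ge[of n A] codes_upto_least_code[of A n]
      not_less_Least[of _ "\<lambda>m. n \<le> m \<and> codes_upto A n m"]
    unfolding least_code_def[symmetric] by (metis nat_neq_iff)
  then show ?thesis
    unfolding segment_codes_def by blast
qed

definition Forall :: "nat \<Rightarrow> aform \<Rightarrow> aform" where
  "Forall x \<phi> = Neg (Exists x (Neg \<phi>))"

definition Imp :: "aform \<Rightarrow> aform \<Rightarrow> aform" where
  "Imp \<phi> \<psi> = Neg (Conj \<phi> (Neg \<psi>))"

definition Iff :: "aform \<Rightarrow> aform \<Rightarrow> aform" where
  "Iff \<phi> \<psi> = Conj (Imp \<phi> \<psi>) (Imp \<psi> \<phi>)"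

text \<open>Variable \<open>1\<close> stands for the length of the segment and variable \<open>v\<close> for its code.\<close>

definition codes_upto_form :: "nat \<Rightarrow> aform" where
  "codes_upto_form v = Exists 3 (Exists 4 (Conj
     (Eq (Var v) (Add (Mult (Add (Var 3) (Var 4)) (Add (Var 3) (Var 4))) (Var 3)))
     (Forall 5 (Imp (Less (Var 5) (Var 1))
        (Iff (Mem (Var 5)) (Exists 6 (Eq (Var 3)
           (Mult (Add One (Mult (Add (Var 5) One) (Var 4))) (Var 6)))))))))"

definition bounded_code_form :: "nat \<Rightarrow> aform" where
  "bounded_code_form v = Conj (Neg (Less (Var v) (Var 1))) (codes_upto_form v)"

text \<open>Variable \<open>0\<close> is the candidate code and variable \<open>2\<close> a smaller
  competitor for the same length.\<close>

definition segment_codes_form :: aform where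
  "segment_codes_form = Exists 1 (Conj (bounded_code_form 0)
     (Forall 2 (Imp (Less (Var 2) (Var 0)) (Neg (bounded_code_form 2)))))"

lemma sat_Forall [simp]: "aform_sat A e (Forall x \<phi>) \<longleftrightarrow> (\<forall>n. aform_sat A (e(x := n)) \<phi>)"
  by (simp add: Forall_def)

lemma sat_Imp [simp]: "aform_sat A e (Imp \<phi> \<psi>) \<longleftrightarrow> (aform_sat A e \<phi> \<longrightarrow> aform_sat A e \<psi>)"
  by (simp add: Imp_def)

lemma sat_Iff [simp]: "aform_sat A e (Iff \<phi> \<psi>) \<longleftrightarrow> (aform_sat A e \<phi> \<longleftrightarrow> aform_sat A e \<psi>)"
  by (auto simp: Iff_def)

text \<open>The bound on \<open>v\<close> prevents capture by the bound variables \<open>3\<close>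
  to \<open>6\<close>.\<close>

lemma sat_bounded_code_form:
  assumes "v \<le> 2"
  shows "aform_sat A e (bounded_code_form v) \<longleftrightarrow> e 1 \<le> e v \<and> codes_upto A (e 1) (e v)"
proof -
  have "v \<noteq> 3" "v \<noteq> 4" "v \<noteq> 5" "v \<noteq> 6"
    using assms by auto
  then show ?thesis
    by (simp add: bounded_code_form_def codes_upto_form_def codes_upto_def dvd_def not_less)
qed

lemma arith_definable_segment_codes: "arith_definable_from A (segment_codes A)"
  unfolding arith_definable_from_def
proof (intro exI conjI)
  show "free_vars segment_codes_form \<subseteq> {0}"
    by (auto simp: segment_codes_form_def bounded_code_form_def codes_upto_form_def
        Forall_def Imp_def Iff_def)
  show "segment_codes A = {n. aform_sat A (\<lambda>_. n) segment_codes_form}"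
    by (simp add: set_eq_iff mem_segment_codes_iff segment_codes_form_def sat_bounded_code_form)
qed

theorem theorem3p1:
  fixes X :: "nat set set"
  assumes "arithmetically_closed X"
    and "ccc (mod_Fin X) almost_subset"
  shows "countable X"
proof -
  have incompatible: "\<not> compatible_in (mod_Fin X) almost_subset (segment_codes A) (segment_codes B)"
    if "A \<noteq> B" for A B
  proof
    assume "compatible_in (mod_Fin X) almost_subset (segment_codes A) (segment_codes B)"
    then obtain C where "infinite C" "finite (C - segment_codes A)" "finite (C - segment_codes B)"
      unfolding compatible_in_def mod_Fin_def almost_subset_def by blast
    \<comment> \<open>A common lower bound would be covered by three finite sets.\<close>
    moreover have "C \<subseteq> (C - segment_codes A) \<union> (C - segment_codes B)
        \<union> (segment_codes A \<inter> segment_codes B)"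
      by blast
    ultimately show False
      using finite_segment_codes_Int[OF that] by (meson finite_UnI finite_subset)
  qed
  have "segment_codes ` X \<subseteq> mod_Fin X"
    using assms(1) arith_definable_segment_codes infinite_segment_codes
    unfolding arithmetically_closed_def mod_Fin_def by blast
  moreover have "pairwise (\<lambda>a b. \<not> compatible_in (mod_Fin X) almost_subset a b) (segment_codes ` X)"
    by (rule pairwise_imageI) (rule incompatible)
  ultimately have "countable (segment_codes ` X)"
    using assms(2) unfolding ccc_def antichain_in_def by blast
  moreover have "inj_on segment_codes X"
  proof (rule inj_onI, rule ccontr)
    fix A B
    assume "segment_codes A = segment_codes B" "A \<noteq> B"
    \<comment> \<open>Equal images would have an infinite set as their intersection.\<close>
    then show False
      using finite_segment_codes_Int[of A B] infinite_segment_codes[of B] by simp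
  qed
  ultimately show ?thesis
    by (rule countable_image_inj_on)
qed

end
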